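(* Let $I,J\subseteq\mathbb{R}$ be open intervals and let $f:I\to J$ and $g:J\to\mathbb{R}$ be infinitely differentiable. Let $F^{\Delta}(n,k,x)$ be the composita of $f(x+z)-f(x)$ for $x\in I$, and let $G^{\Delta}(n,k,u)$ be the composita of $g(u+z)-g(u)$ for $u\in J$. Then for the composition $y(x)=g(f(x))$, the composita of the generating function $Y(x,z)=g(f(x+z))-g(f(x))$ is $$Y^{\Delta}(n,m,x)=\sum_{k=m}^{n}F^{\Delta}(n,k,x)\,G^{\Delta}(k,m,f(x))$$ for all integers $n\ge m\ge 1$ and all $x\in I$.
   Context: For an infinitely differentiable function $h$, the expression $h(x+z)-h(x)$ denotes the formal power series $\sum_{n\ge 1}\frac{h^{(n)}(x)}{n!}z^n$ in $z$. Its composita is the array $$H^{\Delta}(n,k,x)=\sum_{\substack{\lambda_1+\cdots+\lambda_k=n\\ \lambda_1,\dots,\lambda_k\ge 1}}\frac{h^{(\lambda_1)}(x)}{\lambda_1!}\cdots\frac{h^{(\lambda_k)}(x)}{\lambda_k!},\qquad n\ge k\ge 1,$$ the sum being over all compositions of $n$ into exactly $k$ positive parts; equivalently, $[h(x+z)-h(x)]^k=\sum_{n\ge k}H^{\Delta}(n,k,x)z^n$. In the claim, $Y(x,z)=y(x+z)-y(x)$, that is, $Y^{\Delta}$ is this array for $h=y=g\circ f$. *)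

theory Defs
  imports "HOL-Analysis.Analysis" "HOL-Computational_Algebra.Formal_Power_Series"
begin

(* For open S the iterated derivatives on S depend only on the values of h on S. *)
definition smooth_on :: "(real \<Rightarrow> real) \<Rightarrow> real set \<Rightarrow> bool" where
  "smooth_on h S \<longleftrightarrow> (\<forall>n. \<forall>x\<in>S. (deriv ^^ n) h differentiable (at x))"

(* The formal power series in z denoted by h (x + z) - h x. *)
definition increment_fps :: "(real \<Rightarrow> real) \<Rightarrow> real \<Rightarrow> real fps" where
  "increment_fps h x = Abs_fps (\<lambda>n. if n = 0 then 0 else (deriv ^^ n) h x / fact n)"

definition compositions :: "nat \<Rightarrow> nat \<Rightarrow> nat list set" where
  "compositions n k = {ls \<in> natpermute n k. \<forall>l\<in>set ls. l \<ge> 1}"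

lemma finite_compositions: "finite (compositions n k)"
  unfolding compositions_def using natpermute_finite[of n k] by simp

definition composita :: "real fps \<Rightarrow> nat \<Rightarrow> nat \<Rightarrow> real" where
  "composita H n k = (\<Sum>ls\<in>compositions n k. \<Prod>l\<leftarrow>ls. fps_nth H l)"

end

theory Submission
  imports Defs
begin

text \<open>
  The composita of a series \<open>H\<close> with zero constant term collects the coefficients of the powers of
  \<open>H\<close>, so the formula says that Taylor expansion is compatible with composition, followed by
  \<open>(A \<circ> B)^m = A^m \<circ> B\<close> for formal series. The former is the formal Faa di Bruno formula:
  differentiating the coefficients of \<open>S = (g(u + z) - g(u)) \<circ> (f(x + z) - f(x))\<close>, \<open>u = f(x)\<close>, with
  respect to \<open>x\<close> has, up to the constant term, the same effect as differentiating \<open>S\<close> formally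
  with respect to \<open>z\<close>. Hence \<open>n!\<close> times the coefficient of \<open>z^n\<close> in \<open>S\<close> is the \<open>n\<close>-th
  derivative of \<open>g \<circ> f\<close>, by induction on \<open>n\<close>.
\<close>

unbundle no vec_syntax and fps_syntax

text \<open>The general coefficient formula for powers sums over lists of naturals that may contain
  0. A zero entry contributes the factor \<open>H $ 0 = 0\<close>, so only compositions into
  positive parts survive.\<close>

lemma fps_power_nth_eq_composita:
  assumes "H $ 0 = 0"
  shows "(H ^ k) $ n = composita H n k"
proof -
  have "(H ^ k) $ n = (\<Sum>v\<in>natpermute n k. \<Prod>l\<leftarrow>v. H $ l)"
  proof (cases k)
    case 0
    moreover have "natpermute n 0 = (if n = 0 then {[]} else {})"
      by (auto simp: natpermute_def)
    ultimately show ?thesis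
      by simp
  next
    case (Suc j)
    have "(\<Prod>i=0..j. H $ (v ! i)) = (\<Prod>l\<leftarrow>v. H $ l)" if "v \<in> natpermute n k" for v
    proof -
      have "length v = Suc j"
        using that Suc by (simp add: natpermute_def)
      then show ?thesis
        by (simp add: prod.list_conv_set_nth atLeastLessThanSuc_atLeastAtMost)
    qed
    then show ?thesis
      using Suc by (simp add: fps_power_nth del: power_Suc)
  qed
  also have "\<dots> = composita H n k"
    unfolding composita_def
  proof (rule sum.mono_neutral_right)
    show "\<forall>v\<in>natpermute n k - compositions n k. (\<Prod>l\<leftarrow>v. H $ l) = 0"
      using assms by (force simp: compositions_def prod_list_zero_iff image_iff Suc_le_eq)
  qed (auto simp: compositions_def natpermute_finite)
  finally show ?thesis .
qed

text \<open>The parameter is differentiated while \<open>z\<close> stays formal. Each coefficient of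
  a product, power or composition is a finite sum, so the usual rules apply coefficientwise.\<close>

definition has_coeff_deriv :: "(real \<Rightarrow> real fps) \<Rightarrow> real fps \<Rightarrow> real \<Rightarrow> bool" where
  "has_coeff_deriv A A' x \<longleftrightarrow> (\<forall>n. ((\<lambda>t. A t $ n) has_real_derivative A' $ n) (at x))"

lemma has_coeff_deriv_mult:
  assumes "has_coeff_deriv A A' x" "has_coeff_deriv B B' x"
  shows "has_coeff_deriv (\<lambda>t. A t * B t) (A' * B x + A x * B') x"
  unfolding has_coeff_deriv_def fps_mult_nth
proof
  fix n
  have "((\<lambda>t. \<Sum>i=0..n. A t $ i * B t $ (n - i)) has_real_derivative
      (\<Sum>i=0..n. A x $ i * B' $ (n - i) + A' $ i * B x $ (n - i))) (at x)"
    using assms unfolding has_coeff_deriv_def by (intro DERIV_sum DERIV_mult') auto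
  then show "((\<lambda>t. \<Sum>i=0..n. A t $ i * B t $ (n - i)) has_real_derivative
      (A' * B x + A x * B') $ n) (at x)"
    by (simp add: fps_mult_nth sum.distrib add.commute)
qed

lemma has_coeff_deriv_power:
  assumes "has_coeff_deriv A A' x"
  shows "has_coeff_deriv (\<lambda>t. A t ^ k) (of_nat k * A x ^ (k - 1) * A') x"
proof (induction k)
  case 0
  show ?case
    by (simp add: has_coeff_deriv_def)
next
  case (Suc k)
  have "A' * A x ^ k + A x * (of_nat k * A x ^ (k - 1) * A') =
      of_nat (Suc k) * A x ^ (Suc k - 1) * A'"
    by (cases k) (simp_all add: algebra_simps)
  with has_coeff_deriv_mult[OF assms Suc.IH] show ?case
    by simp
qed

text \<open>The left side is what results from differentiating the powers of the inner series in
  \<open>fps_compose_nth\<close>, with \<open>D\<close> as derivative of \<open>B\<close>.\<close>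

lemma fps_deriv_compose_mult_nth:
  assumes "B $ 0 = (0 :: real)" "D $ 0 = 0"
  shows "(\<Sum>i=0..n. A $ i * (of_nat i * B ^ (i - 1) * D) $ n) = ((fps_deriv A oo B) * D) $ n"
proof -
  \<comment> \<open>As \<open>(B ^ i) $ j = 0\<close> for \<open>j < i\<close>, all inner sums may
    run up to \<open>n\<close>, so that the two sums can be swapped.\<close>
  have "((fps_deriv A oo B) * D) $ n =
      (\<Sum>j=0..n. \<Sum>i=0..n. fps_deriv A $ i * (B ^ i) $ j * D $ (n - j))"
    unfolding fps_mult_nth fps_compose_nth sum_distrib_right
    by (intro sum.cong refl sum.mono_neutral_left)
       (auto simp: startsby_zero_power_prefix[OF assms(1)])
  also have "\<dots> = (\<Sum>i=0..n. fps_deriv A $ i * (B ^ i * D) $ n)"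
    by (subst sum.swap) (simp add: fps_mult_nth sum_distrib_left mult.assoc)
  \<comment> \<open>\<open>B ^ n * D\<close> has no term below degree \<open>n + 1\<close>. Dropping
    \<open>i = n\<close> makes room for the index shift that follows.\<close>
  also have "\<dots> = (\<Sum>i<n. fps_deriv A $ i * (B ^ i * D) $ n)"
  proof -
    have "(B ^ n) $ i * D $ (n - i) = 0" if "i \<le> n" for i
      using that assms startsby_zero_power_prefix[OF assms(1), of n] by (cases "i = n") auto
    then have "(B ^ n * D) $ n = 0"
      unfolding fps_mult_nth by (intro sum.neutral) auto
    then show ?thesis
      by (simp add: atLeast0AtMost flip: lessThan_Suc_atMost)
  qed
  also have "\<dots> = (\<Sum>i<n. A $ Suc i * (of_nat (Suc i) * B ^ i * D) $ n)"
    by (intro sum.cong refl) (simp add: mult.assoc fps_of_nat[symmetric] del: of_nat_Suc)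
  also have "\<dots> = (\<Sum>i=0..n. A $ i * (of_nat i * B ^ (i - 1) * D) $ n)"
    using sum.lessThan_Suc_shift[of "\<lambda>i. A $ i * (of_nat i * B ^ (i - 1) * D) $ n" n]
    by (simp add: atLeast0AtMost lessThan_Suc_atMost del: of_nat_Suc)
  finally show ?thesis ..
qed

text \<open>Both series move with the parameter: the first summand comes from the coefficients of
  the outer series, the second from the powers of the inner one.\<close>

lemma has_coeff_deriv_compose:
  assumes A: "has_coeff_deriv A A' x" and B: "has_coeff_deriv B B' x"
    and 0: "B x $ 0 = 0" "B' $ 0 = 0"
  shows "has_coeff_deriv (\<lambda>t. A t oo B t) ((A' oo B x) + (fps_deriv (A x) oo B x) * B') x"
  unfolding has_coeff_deriv_def
proof
  fix n
  have "((\<lambda>t. \<Sum>i=0..n. A t $ i * (B t ^ i) $ n) has_real_derivative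
      (\<Sum>i=0..n. A x $ i * (of_nat i * B x ^ (i - 1) * B') $ n + A' $ i * (B x ^ i) $ n)) (at x)"
    using A has_coeff_deriv_power[OF B] unfolding has_coeff_deriv_def
    by (intro DERIV_sum DERIV_mult') auto
  then show "((\<lambda>t. (A t oo B t) $ n) has_real_derivative
      ((A' oo B x) + (fps_deriv (A x) oo B x) * B') $ n) (at x)"
    by (simp add: fps_compose_nth sum.distrib fps_deriv_compose_mult_nth[OF 0] add.commute
         del: One_nat_def)
qed

lemma increment_fps_nth_0 [simp]: "increment_fps h x $ 0 = 0"
  by (simp add: increment_fps_def)

lemma increment_fps_nth_Suc_0 [simp]: "increment_fps h x $ Suc 0 = deriv h x"
  by (simp add: increment_fps_def)

lemma smooth_on_iterated_DERIV:
  assumes "smooth_on h S" "x \<in> S"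
  shows "((deriv ^^ n) h has_real_derivative (deriv ^^ Suc n) h x) (at x)"
  using assms by (simp add: smooth_on_def DERIV_deriv_iff_real_differentiable)

text \<open>For n \<ge> 1, differentiating h^(n)/n! gives (n+1) times the next coefficient. The
  constant coefficient is identically 0, whereas \<open>fps_deriv\<close> has h'(x) there; hence the
  correction.\<close>

lemma increment_fps_has_coeff_deriv:
  assumes "smooth_on h S" "x \<in> S"
  shows "has_coeff_deriv (increment_fps h)
    (fps_deriv (increment_fps h x) - fps_const (deriv h x)) x"
  unfolding has_coeff_deriv_def
proof
  fix n
  show "((\<lambda>t. increment_fps h t $ n) has_real_derivative
      (fps_deriv (increment_fps h x) - fps_const (deriv h x)) $ n) (at x)"
  proof (cases n)
    case (Suc k)
    have "((\<lambda>t. (deriv ^^ n) h t / fact n) has_real_derivative (deriv ^^ Suc n) h x / fact n) (at x)"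
      by (intro DERIV_cdivide smooth_on_iterated_DERIV[OF assms])
    with Suc show ?thesis
      by (simp add: increment_fps_def divide_simps)
  qed simp
qed

lemma increment_fps_compose:
  assumes "open I" "f \<in> I \<rightarrow> J" "smooth_on f I" "smooth_on g J" "x \<in> I"
  shows "increment_fps (g \<circ> f) x = increment_fps g (f x) oo increment_fps f x"
proof -
  define S where "S t = increment_fps g (f t) oo increment_fps f t" for t
  have chain: "(f has_real_derivative deriv f t) (at t)"
      "(g has_real_derivative deriv g (f t)) (at (f t))" if "t \<in> I" for t
    using smooth_on_iterated_DERIV[OF assms(3) that, of 0]
      smooth_on_iterated_DERIV[OF assms(4), of "f t" 0] assms(2) that by auto
  have S_deriv: "has_coeff_deriv S (fps_deriv (S t) - fps_const (deriv f t * deriv g (f t))) t"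
    if t: "t \<in> I" for t
  proof -
    let ?A = "increment_fps g (f t)" and ?B = "increment_fps f t"
    define c d where "c = fps_const (deriv f t)" and "d = fps_const (deriv g (f t))"
    have "f t \<in> J"
      using assms(2) t by auto
    \<comment> \<open>The factor \<open>c\<close> arises because the base point \<open>f t\<close>
      itself moves with \<open>t\<close>.\<close>
    have "has_coeff_deriv (\<lambda>t. increment_fps g (f t)) ((fps_deriv ?A - d) * c) t"
      unfolding has_coeff_deriv_def
    proof
      fix n
      have "((\<lambda>u. increment_fps g u $ n) has_real_derivative (fps_deriv ?A - d) $ n) (at (f t))"
        using increment_fps_has_coeff_deriv[OF assms(4) \<open>f t \<in> J\<close>]
        by (simp add: has_coeff_deriv_def d_def)
      from DERIV_chain2[OF this chain(1)[OF t]]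
      show "((\<lambda>t. increment_fps g (f t) $ n) has_real_derivative ((fps_deriv ?A - d) * c) $ n) (at t)"
        by (simp only: c_def fps_mult_right_const_nth)
    qed
    moreover have "has_coeff_deriv (increment_fps f) (fps_deriv ?B - c) t"
      using increment_fps_has_coeff_deriv[OF assms(3) t] by (simp add: c_def)
    ultimately have "has_coeff_deriv S
        (((fps_deriv ?A - d) * c oo ?B) + (fps_deriv ?A oo ?B) * (fps_deriv ?B - c)) t"
      unfolding S_def[abs_def] by (rule has_coeff_deriv_compose) (simp_all add: c_def)
    also have "(fps_deriv ?A - d) * c oo ?B = ((fps_deriv ?A oo ?B) - d) * c"
      by (simp add: fps_compose_mult_distrib fps_compose_sub_distrib c_def d_def)
    \<comment> \<open>The mixed terms \<open>(fps_deriv ?A oo ?B) * c\<close> cancel; what remains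
      is the formal chain rule for \<open>S t\<close>, up to a constant.\<close>
    also have "((fps_deriv ?A oo ?B) - d) * c + (fps_deriv ?A oo ?B) * (fps_deriv ?B - c)
        = (fps_deriv ?A oo ?B) * fps_deriv ?B - c * d"
      by (simp add: algebra_simps)
    also have "\<dots> = fps_deriv (S t) - fps_const (deriv f t * deriv g (f t))"
      by (simp add: S_def fps_compose_deriv c_def d_def)
    finally show ?thesis .
  qed
  \<comment> \<open>Order 0 is left out because \<open>S t\<close> has constant term 0. The claim
    covers all of \<open>I\<close>, since the induction step differentiates it in a neighbourhood of
    \<open>t\<close>.\<close>
  have "(deriv ^^ Suc n) (g \<circ> f) t = fact (Suc n) * S t $ Suc n" if "t \<in> I" for n t
    using that
  proof (induction n arbitrary: t)
    case 0
    have "deriv (g \<circ> f) t = deriv g (f t) * deriv f t"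
      using DERIV_chain[OF chain(2,1)[OF 0]] by (rule DERIV_imp_deriv)
    then show ?case
      by (simp add: S_def fps_compose_nth o_def)
  next
    case (Suc n)
    have "((\<lambda>t. fact (Suc n) * S t $ Suc n) has_real_derivative
        fact (Suc n) * (fps_deriv (S t) - fps_const (deriv f t * deriv g (f t))) $ Suc n) (at t)"
      by (rule DERIV_cmult[OF S_deriv[OF Suc.prems, unfolded has_coeff_deriv_def, rule_format]])
    \<comment> \<open>The constant correction does not reach the coefficient at
      \<open>Suc n\<close>.\<close>
    also have "fact (Suc n) * (fps_deriv (S t) - fps_const (deriv f t * deriv g (f t))) $ Suc n
        = fact (Suc (Suc n)) * S t $ Suc (Suc n)"
      by (simp add: algebra_simps)
    finally have "((deriv ^^ Suc n) (g \<circ> f) has_real_derivative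
        fact (Suc (Suc n)) * S t $ Suc (Suc n)) (at t)"
      by (rule has_field_derivative_transform_within_open[OF _ assms(1) Suc.prems])
         (simp only: Suc.IH)
    then have "deriv ((deriv ^^ Suc n) (g \<circ> f)) t = fact (Suc (Suc n)) * S t $ Suc (Suc n)"
      by (rule DERIV_imp_deriv)
    then show ?case
      by (simp only: funpow.simps(2) o_apply[of deriv])
  qed
  then have "increment_fps (g \<circ> f) x $ n = S x $ n" for n
    using assms(5) by (cases n) (simp_all add: increment_fps_def S_def del: funpow.simps fact_Suc)
  then show ?thesis
    by (simp add: fps_eq_iff S_def)
qed

theorem theorem3p6:
  fixes f g :: "real \<Rightarrow> real" and I J :: "real set" and x :: real and n m :: nat
  assumes "open I" and "is_interval I"
    and "open J" and "is_interval J"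
    and "f \<in> I \<rightarrow> J"
    and "smooth_on f I" and "smooth_on g J"
    and "1 \<le> m" and "m \<le> n" and "x \<in> I"
  shows "composita (increment_fps (g \<circ> f) x) n m =
    (\<Sum>k = m..n. composita (increment_fps f x) n k * composita (increment_fps g (f x)) k m)"
proof -
  let ?A = "increment_fps g (f x)" and ?B = "increment_fps f x"
  have "composita (increment_fps (g \<circ> f) x) n m = ((?A oo ?B) ^ m) $ n"
    using increment_fps_compose[OF assms(1,5,6,7,10)]
    by (simp flip: fps_power_nth_eq_composita)
  also have "\<dots> = (\<Sum>k=0..n. (?B ^ k) $ n * (?A ^ m) $ k)"
    by (simp add: fps_compose_power fps_compose_nth mult.commute)
  \<comment> \<open>\<open>?A ^ m\<close> has no terms below degree \<open>m\<close>.\<close>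
  also have "\<dots> = (\<Sum>k=m..n. (?B ^ k) $ n * (?A ^ m) $ k)"
    by (rule sum.mono_neutral_right) (auto simp: startsby_zero_power_prefix)
  finally show ?thesis
    by (simp add: fps_power_nth_eq_composita)
qed

end
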